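(* Let a (nondegenerate) tetrahedron with vertices $x,y,z,w$ be placed so that the basic triangle $x=(x_1,x_2,0)$, $y=(y_1,y_2,0)$, $z=(z_1,z_2,0)$ lies in the horizontal plane, oriented counterclockwise, and $w=(w_1,w_2,w_3)$ with $w_3>0$. Let $r$ be its inradius, $R$ its circumradius, $d$ the distance between its incenter and circumcenter, let $c=(c_1,c_2,0)$ be the point where the insphere touches the basic triangle, and let $(o_1,o_2)$ be the circumcenter of the basic triangle in its plane. Let the gap be $\Gamma=(R^2-d^2-3r^2)^2-(2rR)^2$, and let $a_0,A,B,u_1,u_2,v_1,v_2$ be as defined in the context. (a) If the basic triangle is touched by the insphere at its circumcenter, i.e. $c_1=o_1$, $c_2=o_2$, then $u_1=u_2=0$ and $$\Gamma=\frac{r^2}{64\,a_0^5\,(A-Br^2)}\,\|x-y\|^4\,\|y-z\|^4\,\|z-x\|^4\,(g_1^2+g_2^2),$$ where $$\begin{aligned} g_1={}&(x_1^2+3x_2^2)(z_2-y_2)+(y_1^2+3y_2^2)(x_2-z_2)+(z_1^2+3z_2^2)(y_2-x_2)\\ &+2x_1x_2(z_1-y_1)+2y_1y_2(x_1-z_1)+2z_1z_2(y_1-x_1),\\ g_2={}&(x_2^2+3x_1^2)(y_1-z_1)+(y_2^2+3y_1^2)(z_1-x_1)+(z_2^2+3z_1^2)(x_1-y_1)\\ &+2x_1x_2(y_2-z_2)+2y_1y_2(z_2-x_2)+2z_1z_2(x_2-y_2). \end{aligned}$$ (b) If the basic triangle is touched by the insphere at the incenter of the basic triangle, then $v_1=v_2=0$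 and $$\Gamma=\frac{16\,a_0\,r^6}{A-Br^2}\,\big((c_1-o_1)^2+(c_2-o_2)^2\big).$$ (c) If the basic triangle is regular (equilateral) and $c_1=o_1$, $c_2=o_2$, then $\Gamma=0$.
   Context: Norms $\|\cdot\|$ are Euclidean. The quantities are: $a_0 = x_1y_2+y_1z_2+z_1x_2-y_1x_2-z_1y_2-x_1z_2$ (twice the area of triangle $xyz$), $a_x = c_1y_2+y_1z_2+z_1c_2-y_1c_2-z_1y_2-c_1z_2$ (twice the area of $cyz$), $a_y = x_1c_2+c_1z_2+z_1x_2-c_1x_2-z_1c_2-x_1z_2$ (twice the area of $xcz$), $a_z = x_1y_2+y_1c_2+c_1x_2-y_1x_2-c_1y_2-x_1c_2$ (twice the area of $xyc$). $A=a_xa_ya_z$, and $B=\|x\|^2a_x+\|y\|^2a_y+\|z\|^2a_z-\|c\|^2a_0$. $o_1,o_2$ satisfy $2a_0o_1=\|x\|^2(y_2-z_2)+\|y\|^2(z_2-x_2)+\|z\|^2(x_2-y_2)$, $2a_0o_2=\|x\|^2(z_1-y_1)+\|y\|^2(x_1-z_1)+\|z\|^2(y_1-x_1)$. $u_1=4a_0(c_1-o_1)$, $u_2=4a_0(c_2-o_2)$. $$\begin{aligned} v_1={}& c_1(c_1^2+c_2^2)a_0-2c_1^2a_0o_1\\ &+ y_1z_1(y_2-z_2)(c_1^2-x_1^2-(c_2-x_2)^2)\\ &+ z_1x_1(z_2-x_2)(c_1^2-y_1^2-(c_2-y_2)^2)\\ &+ x_1y_1(x_2-y_2)(c_1^2-z_1^2-(c_2-z_2)^2)\\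 &+ c_1^2\big(x_2^2(z_2-y_2)+y_2^2(x_2-z_2)+z_2^2(y_2-x_2)\big)\\ &+ c_2^2\big(x_1^2(z_2-y_2)+y_1^2(x_2-z_2)+z_1^2(y_2-x_2)\big)\\ &+ x_1^2(y_2-z_2)\big(c_1(y_1+z_1)+c_2(y_2+z_2)-y_2z_2\big)\\ &+ y_1^2(z_2-x_2)\big(c_1(z_1+x_1)+c_2(z_2+x_2)-z_2x_2\big)\\ &+ z_1^2(x_2-y_2)\big(c_1(x_1+y_1)+c_2(x_2+y_2)-x_2y_2\big)\\ &+ 2c_1c_2\big(x_1x_2(y_2-z_2)+y_1y_2(z_2-x_2)+z_1z_2(x_2-y_2)\big)\\ &+ 2c_1c_2\big(x_1(z_2^2-y_2^2)+y_1(x_2^2-z_2^2)+z_1(y_2^2-x_2^2)\big)\\ &+ c_1\big(x_1x_2(z_2^2-y_2^2)+y_1y_2(x_2^2-z_2^2)+z_1z_2(y_2^2-x_2^2)\big)\\ &+ 3c_1\big(x_1y_2z_2(y_2-z_2)+x_2y_1z_2(z_2-x_2)+x_2y_2z_1(x_2-y_2)\big), \end{aligned}$$ $$\begin{aligned} v_2={}& c_2(c_1^2+c_2^2)a_0-2c_2^2a_0o_2\\ &+ y_2z_2(y_1-z_1)((c_1-x_1)^2-c_2^2+x_2^2)\\ &+ x_2z_2(z_1-x_1)((c_1-y_1)^2-c_2^2+y_2^2)\\ &+ x_2y_2(x_1-y_1)((c_1-z_1)^2-c_2^2+z_2^2)\\ &+ c_1^2\big(x_2^2(y_1-z_1)+y_2^2(z_1-x_1)+z_2^2(x_1-y_1)\big)\\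 &+ c_2^2\big(x_1^2(y_1-z_1)+y_1^2(z_1-x_1)+z_1^2(x_1-y_1)\big)\\ &+ x_2^2(z_1-y_1)\big(c_1(y_1+z_1)+c_2(y_2+z_2)-y_1z_1\big)\\ &+ y_2^2(x_1-z_1)\big(c_1(z_1+x_1)+c_2(z_2+x_2)-z_1x_1\big)\\ &+ z_2^2(y_1-x_1)\big(c_1(x_1+y_1)+c_2(x_2+y_2)-x_1y_1\big)\\ &+ 2c_1c_2\big(x_1x_2(z_1-y_1)+y_1y_2(x_1-z_1)+z_1z_2(y_1-x_1)\big)\\ &+ 2c_1c_2\big(x_2(y_1^2-z_1^2)+y_2(z_1^2-x_1^2)+z_2(x_1^2-y_1^2)\big)\\ &+ c_2\big(x_1x_2(y_1^2-z_1^2)+y_1y_2(z_1^2-x_1^2)+z_1z_2(x_1^2-y_1^2)\big)\\ &+ 3c_2\big(x_1^2(y_2z_1-y_1z_2)+y_1^2(x_1z_2-x_2z_1)+z_1^2(x_2y_1-x_1y_2)\big). \end{aligned}$$ *)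

theory Defs
  imports "HOL-Analysis.Analysis"
begin

text \<open>
  In the next definitions \<open>V\<close> is the vertex set of a full-dimensional simplex (a triangle in the plane,
  a tetrahedron in space); its facets are the hulls of the sets \<open>V - {v}\<close>. The sphere lies inside
  the simplex, so meeting a facet in a single point means being tangent to it.
\<close>

definition touches_at :: "'a::euclidean_space set \<Rightarrow> 'a set \<Rightarrow> 'a \<Rightarrow> bool"
  where "touches_at S F t \<longleftrightarrow> S \<inter> F = {t}"

definition is_insphere :: "'a::euclidean_space set \<Rightarrow> 'a \<Rightarrow> real \<Rightarrow> bool"
  where "is_insphere V p r \<longleftrightarrow>
    0 < r \<and> cball p r \<subseteq> convex hull V \<and>
    (\<forall>v\<in>V. \<exists>t. touches_at (sphere p r) (convex hull (V - {v})) t)"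

definition is_circumsphere :: "'a::euclidean_space set \<Rightarrow> 'a \<Rightarrow> real \<Rightarrow> bool"
  where "is_circumsphere V q R \<longleftrightarrow> V \<subseteq> sphere q R"

definition is_incenter :: "'a::euclidean_space set \<Rightarrow> 'a \<Rightarrow> bool"
  where "is_incenter V p \<longleftrightarrow> (\<exists>r. is_insphere V p r)"

definition is_circumcenter :: "'a::euclidean_space set \<Rightarrow> 'a \<Rightarrow> bool"
  where "is_circumcenter V q \<longleftrightarrow> (\<exists>R. is_circumsphere V q R)"

definition flat :: "real^2 \<Rightarrow> real^3"
  where "flat p = vector [p$1, p$2, 0]"

definition gap :: "real \<Rightarrow> real \<Rightarrow> real \<Rightarrow> real"
  where "gap r R d = (R^2 - d^2 - 3 * r^2)^2 - (2 * r * R)^2"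

text \<open>
  Twice the signed area of a plane triangle, positive iff the vertices are nondegenerate and
  in counterclockwise order.
\<close>

definition area2 :: "real^2 \<Rightarrow> real^2 \<Rightarrow> real^2 \<Rightarrow> real"
  where "area2 x y z =
    x$1 * y$2 + y$1 * z$2 + z$1 * x$2 - y$1 * x$2 - z$1 * y$2 - x$1 * z$2"

definition coeff_A :: "real^2 \<Rightarrow> real^2 \<Rightarrow> real^2 \<Rightarrow> real^2 \<Rightarrow> real"
  where "coeff_A x y z c = area2 c y z * area2 x c z * area2 x y c"

definition coeff_B :: "real^2 \<Rightarrow> real^2 \<Rightarrow> real^2 \<Rightarrow> real^2 \<Rightarrow> real"
  where "coeff_B x y z c =
    (norm x)^2 * area2 c y z + (norm y)^2 * area2 x c z + (norm z)^2 * area2 x y c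
    - (norm c)^2 * area2 x y z"

text \<open>Below, \<open>m\<close> is the circumcenter of the triangle \<open>x y z\<close>.\<close>

definition coeff_u1 :: "real^2 \<Rightarrow> real^2 \<Rightarrow> real^2 \<Rightarrow> real^2 \<Rightarrow> real^2 \<Rightarrow> real"
  where "coeff_u1 x y z c m = 4 * area2 x y z * (c$1 - m$1)"

definition coeff_u2 :: "real^2 \<Rightarrow> real^2 \<Rightarrow> real^2 \<Rightarrow> real^2 \<Rightarrow> real^2 \<Rightarrow> real"
  where "coeff_u2 x y z c m = 4 * area2 x y z * (c$2 - m$2)"

definition coeff_v1 :: "real^2 \<Rightarrow> real^2 \<Rightarrow> real^2 \<Rightarrow> real^2 \<Rightarrow> real^2 \<Rightarrow> real"
  where "coeff_v1 x y z c m =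
    c$1 * ((c$1)^2 + (c$2)^2) * area2 x y z - 2 * (c$1)^2 * area2 x y z * m$1
    + y$1 * z$1 * (y$2 - z$2) * ((c$1)^2 - (x$1)^2 - (c$2 - x$2)^2)
    + z$1 * x$1 * (z$2 - x$2) * ((c$1)^2 - (y$1)^2 - (c$2 - y$2)^2)
    + x$1 * y$1 * (x$2 - y$2) * ((c$1)^2 - (z$1)^2 - (c$2 - z$2)^2)
    + (c$1)^2 * ((x$2)^2 * (z$2 - y$2) + (y$2)^2 * (x$2 - z$2) + (z$2)^2 * (y$2 - x$2))
    + (c$2)^2 * ((x$1)^2 * (z$2 - y$2) + (y$1)^2 * (x$2 - z$2) + (z$1)^2 * (y$2 - x$2))
    + (x$1)^2 * (y$2 - z$2) * (c$1 * (y$1 + z$1) + c$2 * (y$2 + z$2) - y$2 * z$2)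
    + (y$1)^2 * (z$2 - x$2) * (c$1 * (z$1 + x$1) + c$2 * (z$2 + x$2) - z$2 * x$2)
    + (z$1)^2 * (x$2 - y$2) * (c$1 * (x$1 + y$1) + c$2 * (x$2 + y$2) - x$2 * y$2)
    + 2 * c$1 * c$2 *
        (x$1 * x$2 * (y$2 - z$2) + y$1 * y$2 * (z$2 - x$2) + z$1 * z$2 * (x$2 - y$2))
    + 2 * c$1 * c$2 *
        (x$1 * ((z$2)^2 - (y$2)^2) + y$1 * ((x$2)^2 - (z$2)^2) + z$1 * ((y$2)^2 - (x$2)^2))
    + c$1 *
        (x$1 * x$2 * ((z$2)^2 - (y$2)^2) + y$1 * y$2 * ((x$2)^2 - (z$2)^2)
          + z$1 * z$2 * ((y$2)^2 - (x$2)^2))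
    + 3 * c$1 *
        (x$1 * y$2 * z$2 * (y$2 - z$2) + x$2 * y$1 * z$2 * (z$2 - x$2)
          + x$2 * y$2 * z$1 * (x$2 - y$2))"

definition coeff_v2 :: "real^2 \<Rightarrow> real^2 \<Rightarrow> real^2 \<Rightarrow> real^2 \<Rightarrow> real^2 \<Rightarrow> real"
  where "coeff_v2 x y z c m =
    c$2 * ((c$1)^2 + (c$2)^2) * area2 x y z - 2 * (c$2)^2 * area2 x y z * m$2
    + y$2 * z$2 * (y$1 - z$1) * ((c$1 - x$1)^2 - (c$2)^2 + (x$2)^2)
    + x$2 * z$2 * (z$1 - x$1) * ((c$1 - y$1)^2 - (c$2)^2 + (y$2)^2)
    + x$2 * y$2 * (x$1 - y$1) * ((c$1 - z$1)^2 - (c$2)^2 + (z$2)^2)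
    + (c$1)^2 * ((x$2)^2 * (y$1 - z$1) + (y$2)^2 * (z$1 - x$1) + (z$2)^2 * (x$1 - y$1))
    + (c$2)^2 * ((x$1)^2 * (y$1 - z$1) + (y$1)^2 * (z$1 - x$1) + (z$1)^2 * (x$1 - y$1))
    + (x$2)^2 * (z$1 - y$1) * (c$1 * (y$1 + z$1) + c$2 * (y$2 + z$2) - y$1 * z$1)
    + (y$2)^2 * (x$1 - z$1) * (c$1 * (z$1 + x$1) + c$2 * (z$2 + x$2) - z$1 * x$1)
    + (z$2)^2 * (y$1 - x$1) * (c$1 * (x$1 + y$1) + c$2 * (x$2 + y$2) - x$1 * y$1)
    + 2 * c$1 * c$2 *
        (x$1 * x$2 * (z$1 - y$1) + y$1 * y$2 * (x$1 - z$1) + z$1 * z$2 * (y$1 - x$1))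
    + 2 * c$1 * c$2 *
        (x$2 * ((y$1)^2 - (z$1)^2) + y$2 * ((z$1)^2 - (x$1)^2) + z$2 * ((x$1)^2 - (y$1)^2))
    + c$2 *
        (x$1 * x$2 * ((y$1)^2 - (z$1)^2) + y$1 * y$2 * ((z$1)^2 - (x$1)^2)
          + z$1 * z$2 * ((x$1)^2 - (y$1)^2))
    + 3 * c$2 *
        ((x$1)^2 * (y$2 * z$1 - y$1 * z$2) + (y$1)^2 * (x$1 * z$2 - x$2 * z$1)
          + (z$1)^2 * (x$2 * y$1 - x$1 * y$2))"

definition coeff_g1 :: "real^2 \<Rightarrow> real^2 \<Rightarrow> real^2 \<Rightarrow> real"
  where "coeff_g1 x y z =
    ((x$1)^2 + 3 * (x$2)^2) * (z$2 - y$2) + ((y$1)^2 + 3 * (y$2)^2) * (x$2 - z$2)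
    + ((z$1)^2 + 3 * (z$2)^2) * (y$2 - x$2)
    + 2 * x$1 * x$2 * (z$1 - y$1) + 2 * y$1 * y$2 * (x$1 - z$1) + 2 * z$1 * z$2 * (y$1 - x$1)"

definition coeff_g2 :: "real^2 \<Rightarrow> real^2 \<Rightarrow> real^2 \<Rightarrow> real"
  where "coeff_g2 x y z =
    ((x$2)^2 + 3 * (x$1)^2) * (y$1 - z$1) + ((y$2)^2 + 3 * (y$1)^2) * (z$1 - x$1)
    + ((z$2)^2 + 3 * (z$1)^2) * (x$1 - y$1)
    + 2 * x$1 * x$2 * (y$2 - z$2) + 2 * y$1 * y$2 * (z$2 - x$2) + 2 * z$1 * z$2 * (x$2 - y$2)"

end

theory Submission
  imports Defs
begin

text \<open>
  The tetrahedron is determined by its base triangle, the touching point \<open>c\<close> and \<open>r\<close>, and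
  everything reduces to the base plane. Write \<open>a\<^sub>i\<close> for the doubled areas that \<open>c\<close> spans with the
  edges of the base, \<open>X\<^sub>i\<close> for the squared edge lengths, \<open>a\<close> for the doubled area of the base, \<open>k\<close>
  for its squared circumradius and \<open>e\<close> for the squared distance from \<open>c\<close> to its circumcenter \<open>m\<close>.

  The incenter lies at height \<open>r\<close> above \<open>c\<close>. Tangency to a lateral face says that the incenter has
  distance \<open>r\<close> from its plane, which gives \<open>w\<^sub>3 (a\<^sub>i\<^sup>2 - r\<^sup>2 X\<^sub>i) = 2 r a\<^sub>i l\<^sub>i\<close> (lemma
  \<open>lateral_face_tangency\<close>), where the \<open>l\<^sub>i\<close> are the areas that the foot of the apex \<open>w\<close> spans with
  the edges. The circumcenter of the tetrahedron lies at some height \<open>h\<close> above \<open>m\<close>, and \<open>h\<close> follows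
  from the height of \<open>w\<close> and the power of its foot in the circumcircle. In the gap the squares of
  \<open>h\<close> cancel: \<open>R\<^sup>2 - d\<^sup>2\<close> and \<open>R\<^sup>2\<close> are \<open>k - e + 2 r h - r\<^sup>2\<close> and \<open>k + h\<^sup>2\<close>, so the gap is affine in
  \<open>h\<close>. Eliminating \<open>w\<^sub>3\<close>, the \<open>l\<^sub>i\<close> and \<open>h\<close> turns the gap, multiplied by \<open>A - B r\<^sup>2\<close>, into a
  polynomial in \<open>r\<^sup>2\<close> with terms of degree 1, 2 and 3 only (lemma \<open>gap_expansion\<close>); the last
  coefficient is \<open>16 a e\<close>.

  If \<open>c\<close> is the circumcenter of the base, then \<open>e = 0\<close>, the coefficient of degree 2 vanishes, and
  that of degree 1 is \<open>X\<^sub>1 X\<^sub>2 X\<^sub>3 - (X\<^sub>2 + X\<^sub>3 - X\<^sub>1) (X\<^sub>3 + X\<^sub>1 - X\<^sub>2) (X\<^sub>1 + X\<^sub>2 - X\<^sub>3)\<close> up to a factor, which is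
  \<open>g\<^sub>1\<^sup>2 + g\<^sub>2\<^sup>2\<close> (lemma \<open>coeff_g_norm_sq\<close>) and zero for equal edges. If \<open>c\<close> is the incenter of the
  base, then \<open>a\<^sub>i\<close> is proportional to the length of the edge, and both lower coefficients vanish
  (lemma \<open>incenter_relations\<close>). That \<open>v\<^sub>1\<close> and \<open>v\<^sub>2\<close> vanish there holds because they are
  combinations of three quadratic forms, one for each vertex, that vanish on the bisectors of the
  angle at that vertex (lemma \<open>coeff_v_bisector_forms\<close>).
\<close>

section \<open>Tangency\<close>

text \<open>
  The inscribed ball lies in the half space \<open>b \<le> n \<bullet> u\<close>, so its center has distance at least \<open>r\<close>
  from the boundary plane; the touching point lies on that plane, so the distance is at most \<open>r\<close>.
\<close>

lemma insphere_facet_distance: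
  fixes V :: "'a::euclidean_space set"
  assumes insphere: "is_insphere V p r" and v: "v \<in> V"
    and facet: "\<And>u. u \<in> V - {v} \<Longrightarrow> n \<bullet> u = b" and apex: "b \<le> n \<bullet> v"
  shows "n \<bullet> p - b = r * norm n"
proof -
  have r: "0 < r" and inside: "cball p r \<subseteq> convex hull V"
    using insphere by (auto simp: is_insphere_def)
  obtain t where t: "t \<in> sphere p r" "t \<in> convex hull (V - {v})"
    using insphere v unfolding is_insphere_def touches_at_def by (metis IntE insertI1)
  have "V - {v} \<subseteq> {u. n \<bullet> u = b}" using facet by auto
  then have "convex hull (V - {v}) \<subseteq> {u. n \<bullet> u = b}"
    by (rule hull_minimal) (rule convex_hyperplane)
  with t have tb: "n \<bullet> t = b" by auto
  have "b \<le> n \<bullet> u" if "u \<in> V" for u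
    using facet[of u] apex that by (cases "u = v") auto
  then have "V \<subseteq> {u. b \<le> n \<bullet> u}" by auto
  then have "convex hull V \<subseteq> {u. b \<le> n \<bullet> u}"
    by (rule hull_minimal) (rule convex_halfspace_ge)
  with inside have half: "b \<le> n \<bullet> u" if "u \<in> cball p r" for u using that by blast
  show ?thesis
  proof (cases "n = 0")
    case True
    then show ?thesis using tb by simp
  next
    case False
    have "n \<bullet> p - b = n \<bullet> (p - t)" using tb by (simp add: inner_diff_right)
    also have "\<dots> \<le> norm n * norm (p - t)" by (rule norm_cauchy_schwarz)
    also have "norm (p - t) = r" using t by (simp add: dist_norm)
    finally have le: "n \<bullet> p - b \<le> r * norm n" by (simp add: mult.commute)
    \<comment> \<open>the point of the ball that is extremal in the direction \<open>- n\<close>\<close>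
    have "p - (r / norm n) *\<^sub>R n \<in> cball p r"
      using r False by (simp add: dist_norm)
    from half[OF this] have "b \<le> n \<bullet> p - (r / norm n) * (norm n)^2"
      by (simp add: inner_diff_right power2_norm_eq_inner)
    then have "r * norm n \<le> n \<bullet> p - b"
      using False by (simp add: power2_eq_square)
    with le show ?thesis by simp
  qed
qed

lemma flat_nth [simp]: "flat p $ 1 = p$1" "flat p $ 2 = p$2" "flat p $ 3 = 0"
  by (simp_all add: flat_def)

lemma norm2_sq: "(norm (v::real^2))^2 = (v$1)^2 + (v$2)^2"
  unfolding power2_norm_eq_inner by (simp add: inner_vec_def sum_2 power2_eq_square)

lemma norm3_sq: "(norm (v::real^3))^2 = (v$1)^2 + (v$2)^2 + (v$3)^2"
  unfolding power2_norm_eq_inner by (simp add: inner_vec_def sum_3 power2_eq_square)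

lemma insphere_center_above_touching_point:
  assumes w3: "0 < w$3"
    and insphere: "is_insphere {flat x, flat y, flat z, w} p r"
    and touch: "touches_at (sphere p r) (convex hull {flat x, flat y, flat z}) (flat c)"
  shows "p$1 = c$1" "p$2 = c$2" "p$3 = r"
proof -
  let ?n = "vector [0, 0, 1] :: real^3"
  have n_inner: "?n \<bullet> u = u$3" for u by (simp add: inner_vec_def sum_3)
  have n_norm: "norm ?n = 1" unfolding norm_eq_sqrt_inner n_inner by simp
  have "?n \<bullet> p - 0 = r * norm ?n"
    by (rule insphere_facet_distance[OF insphere, of w]) (use w3 in \<open>auto simp: n_inner\<close>)
  then show p3: "p$3 = r" by (simp add: n_inner n_norm)
  have "flat c \<in> sphere p r" using touch by (auto simp: touches_at_def)
  then have "(norm (p - flat c))^2 = r^2" by (simp add: dist_norm)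
  then have "(p$1 - c$1)^2 + (p$2 - c$2)^2 = 0" unfolding norm3_sq by (simp add: p3)
  then show "p$1 = c$1" "p$2 = c$2" by simp_all
qed

text \<open>
  Let \<open>a\<close> and \<open>l\<close> be the areas that the edge \<open>xy\<close> spans with \<open>c\<close> and with the foot \<open>f\<close> of the
  apex, and \<open>X\<close> the squared length of the edge. Tangency to the plane through the edge and \<open>w\<close> reads
  \<open>w\<^sub>3 a - r l = r N\<close> with \<open>N\<^sup>2 = w\<^sub>3\<^sup>2 X + l\<^sup>2\<close>; after squaring, \<open>l\<^sup>2\<close> cancels and a factor \<open>w\<^sub>3\<close>
  splits off. As \<open>N\<close> exceeds \<open>\<bar>l\<bar>\<close>, the area \<open>a\<close> is positive.
\<close>

lemma lateral_face_tangency: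
  fixes x y z c :: "real^2" and w p :: "real^3"
  defines "f \<equiv> vector [w$1, w$2] :: real^2"
  assumes ccw: "0 < area2 x y z" and w3: "0 < w$3"
    and insphere: "is_insphere {flat x, flat y, flat z, w} p r"
    and p: "p$1 = c$1" "p$2 = c$2" "p$3 = r"
  shows "0 < area2 x y c"
    and "w$3 * ((area2 x y c)^2 - r^2 * (norm (x - y))^2) = 2 * r * area2 x y c * area2 x y f"
proof -
  have r: "0 < r" using insphere by (simp add: is_insphere_def)
  let ?l = "area2 x y f" and ?a = "area2 x y c"
  \<comment> \<open>the cross product of \<open>w - flat x\<close> and \<open>flat y - flat x\<close>, which points into the tetrahedron\<close>
  define n where "n = (vector [w$3 * (x$2 - y$2), w$3 * (y$1 - x$1), - ?l] :: real^3)"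
  define b where "b = n \<bullet> flat x"
  have n_inner: "n \<bullet> u = w$3 * (x$2 - y$2) * u$1 + w$3 * (y$1 - x$1) * u$2 - ?l * u$3" for u
    by (simp add: n_def inner_vec_def sum_3)
  have f: "f$1 = w$1" "f$2 = w$2" by (simp_all add: f_def)
  have ny: "n \<bullet> flat y = b" and nw: "n \<bullet> w = b"
    unfolding n_inner by (simp_all add: b_def n_inner area2_def f algebra_simps)
  have "n \<bullet> flat z = b + w$3 * area2 x y z"
    unfolding b_def n_inner by (simp add: area2_def algebra_simps)
  with ccw w3 have nz: "b \<le> n \<bullet> flat z" by simp
  have "n \<bullet> p - b = r * norm n"
    by (rule insphere_facet_distance[OF insphere, of "flat z"]) (use ny nw nz b_def in auto)
  moreover have "n \<bullet> p - b = w$3 * ?a - r * ?l"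
    unfolding b_def n_inner by (simp add: area2_def p algebra_simps)
  ultimately have dist: "w$3 * ?a - r * ?l = r * norm n" by simp
  have n_norm: "(norm n)^2 = (w$3)^2 * (norm (x - y))^2 + ?l^2"
    unfolding norm3_sq norm2_sq by (simp add: n_def power2_eq_square algebra_simps)
  have "x \<noteq> y" using ccw by (auto simp: area2_def)
  then have "?l^2 < (norm n)^2" unfolding n_norm using w3 by simp
  then have "\<bar>?l\<bar> < norm n" using power2_less_imp_less[of "\<bar>?l\<bar>" "norm n"] by simp
  then have "0 < r * (?l + norm n)"  using r by (intro mult_pos_pos) linarith+
  also have "\<dots> = w$3 * ?a" using dist by (simp add: algebra_simps)
  finally show "0 < ?a" using w3 by (simp add: zero_less_mult_iff)
  have "(w$3 * ?a - r * ?l)^2 = r^2 * ((w$3)^2 * (norm (x - y))^2 + ?l^2)"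
    unfolding dist by (simp add: power_mult_distrib n_norm)
  moreover have "w$3 * (w$3 * (?a^2 - r^2 * (norm (x - y))^2)) - w$3 * (2 * r * ?a * ?l)
      = (w$3 * ?a - r * ?l)^2 - r^2 * ((w$3)^2 * (norm (x - y))^2 + ?l^2)"
    by algebra
  ultimately have "w$3 * (w$3 * (?a^2 - r^2 * (norm (x - y))^2)) = w$3 * (2 * r * ?a * ?l)"
    by simp
  then show "w$3 * (?a^2 - r^2 * (norm (x - y))^2) = 2 * r * ?a * ?l" using w3 by simp
qed

lemma incenter_side_distance:
  fixes x y z c :: "real^2"
  assumes ccw: "0 < area2 x y z" and insphere: "is_insphere {x, y, z} c k"
  shows "area2 x y c = k * norm (x - y)"
proof -
  define n where "n = (vector [x$2 - y$2, y$1 - x$1] :: real^2)"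
  define b where "b = n \<bullet> x"
  have n_inner: "n \<bullet> u = b + area2 x y u" for u
    by (simp add: b_def n_def inner_vec_def sum_2 area2_def algebra_simps)
  have y: "n \<bullet> y = b" unfolding n_inner by (simp add: area2_def)
  have "n \<bullet> c - b = k * norm n"
    by (rule insphere_facet_distance[OF insphere, of z]) (use y ccw n_inner[of z] b_def in auto)
  moreover have "(norm n)^2 = (norm (x - y))^2"
    unfolding norm2_sq by (simp add: n_def power2_eq_square algebra_simps)
  then have "norm n = norm (x - y)" by simp
  ultimately show ?thesis unfolding n_inner[of c] by simp
qed

section \<open>Metric relations in the base triangle\<close>

lemma heron_area2:
  "4 * (area2 x y z)^2
    = 2 * ((norm (x-y))^2 * (norm (y-z))^2 + (norm (y-z))^2 * (norm (z-x))^2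
        + (norm (z-x))^2 * (norm (x-y))^2)
      - ((norm (x-y))^4 + (norm (y-z))^4 + (norm (z-x))^4)"
proof -
  have 4: "t^4 = (t^2)^2" for t :: real by simp
  show ?thesis unfolding 4 norm2_sq area2_def vector_minus_component by algebra
qed

text \<open>
  Take \<open>c\<close> as the origin. The vector sum of the vertices weighted by these areas is zero; its
  squared length, with the inner products of the vertices expressed by the edges, is the difference
  of the two sides.
\<close>

lemma edge_sum_coeff_B:
  "(norm (y-z))^2 * area2 x c z * area2 x y c + (norm (z-x))^2 * area2 x y c * area2 c y z
      + (norm (x-y))^2 * area2 c y z * area2 x c z
    = area2 x y z * coeff_B x y z c"
  unfolding norm2_sq area2_def coeff_B_def vector_minus_component by algebra

text \<open>
  In terms of the angles, the right side is \<open>X Y Z\<close> times one minus eight times the product of the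
  cosines. Hence \<open>g\<close> is as long as the segment from the circumcenter to the orthocenter, times
  twice \<open>area2 x y z\<close>.
\<close>

lemma coeff_g_norm_sq:
  fixes x y z :: "real^2"
  defines "X \<equiv> (norm (y-z))^2" and "Y \<equiv> (norm (z-x))^2" and "Z \<equiv> (norm (x-y))^2"
  shows "(coeff_g1 x y z)^2 + (coeff_g2 x y z)^2 = X*Y*Z - (Y+Z-X)*(Z+X-Y)*(X+Y-Z)"
  unfolding X_def Y_def Z_def norm2_sq coeff_g1_def coeff_g2_def vector_minus_component by algebra

lemma circumcenter_coordinate_1:
  fixes x y z m :: "real^2"
  assumes eq: "(norm (x-m))^2 = k" "(norm (y-m))^2 = k" "(norm (z-m))^2 = k"
  shows "2 * area2 x y z * m$1
    = (norm x)^2 * (y$2-z$2) + (norm y)^2 * (z$2-x$2) + (norm z)^2 * (x$2-y$2)"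
proof -
  \<comment> \<open>moving the origin to \<open>m\<close>; equal squared norms then contribute zero\<close>
  have "(norm x)^2 * (y$2-z$2) + (norm y)^2 * (z$2-x$2) + (norm z)^2 * (x$2-y$2)
      - 2 * area2 x y z * m$1
    = (norm (x-m))^2 * (y$2-z$2) + (norm (y-m))^2 * (z$2-x$2) + (norm (z-m))^2 * (x$2-y$2)"
    unfolding norm2_sq area2_def vector_minus_component by algebra
  then show ?thesis unfolding eq by algebra
qed

lemma circumcenter_coordinate_2:
  fixes x y z m :: "real^2"
  assumes eq: "(norm (x-m))^2 = k" "(norm (y-m))^2 = k" "(norm (z-m))^2 = k"
  shows "2 * area2 x y z * m$2
    = (norm x)^2 * (z$1-y$1) + (norm y)^2 * (x$1-z$1) + (norm z)^2 * (y$1-x$1)"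
proof -
  have "(norm x)^2 * (z$1-y$1) + (norm y)^2 * (x$1-z$1) + (norm z)^2 * (y$1-x$1)
      - 2 * area2 x y z * m$2
    = (norm (x-m))^2 * (z$1-y$1) + (norm (y-m))^2 * (x$1-z$1) + (norm (z-m))^2 * (y$1-x$1)"
    unfolding norm2_sq area2_def vector_minus_component by algebra
  then show ?thesis unfolding eq by algebra
qed

text \<open>
  \<open>c\<close> is the barycenter of the vertices with the three areas as weights, so the weighted sum of the
  squared distances from \<open>m\<close> to the vertices exceeds the weighted squared distance to \<open>c\<close> by the
  same amount as for the origin in place of \<open>m\<close>. Up to sign and the area, \<open>B\<close> is thus the power of
  \<open>c\<close> in the circumcircle.
\<close>

lemma coeff_B_power:
  fixes x y z c m :: "real^2"
  assumes eq: "(norm (x-m))^2 = k" "(norm (y-m))^2 = k" "(norm (z-m))^2 = k"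
  shows "coeff_B x y z c = area2 x y z * (k - (norm (c-m))^2)"
proof -
  have "coeff_B x y z c + area2 x y z * (norm (c-m))^2
    = (norm (x-m))^2 * area2 c y z + (norm (y-m))^2 * area2 x c z + (norm (z-m))^2 * area2 x y c"
    unfolding norm2_sq area2_def coeff_B_def vector_minus_component by algebra
  also have "\<dots> = k * area2 x y z" unfolding eq area2_def by algebra
  finally show ?thesis by algebra
qed

lemma circumcenter_area:
  fixes x y z m :: "real^2"
  assumes eq: "(norm (x-m))^2 = k" "(norm (y-m))^2 = k" "(norm (z-m))^2 = k"
  shows "4 * area2 x y z * area2 m y z
    = (norm (y-z))^2 * ((norm (z-x))^2 + (norm (x-y))^2 - (norm (y-z))^2)"
  using circumcenter_coordinate_1[OF eq] circumcenter_coordinate_2[OF eq]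
  unfolding norm2_sq area2_def vector_minus_component by algebra

text \<open>
  In terms of the angle at the opposite vertex, the doubled area spanned by an edge and the
  circumcenter is half the squared edge length times the cotangent.
\<close>

lemma circumcenter_areas:
  assumes m: "(norm (x-m))^2 = k" "(norm (y-m))^2 = k" "(norm (z-m))^2 = k"
  shows "4 * area2 x y z * area2 m y z
    = (norm (y-z))^2 * ((norm (z-x))^2 + (norm (x-y))^2 - (norm (y-z))^2)"
    and "4 * area2 x y z * area2 x m z
    = (norm (z-x))^2 * ((norm (x-y))^2 + (norm (y-z))^2 - (norm (z-x))^2)"
    and "4 * area2 x y z * area2 x y m
    = (norm (x-y))^2 * ((norm (y-z))^2 + (norm (z-x))^2 - (norm (x-y))^2)"
  using circumcenter_area[OF m] circumcenter_area[OF m(2,3,1)] circumcenter_area[OF m(3,1,2)]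
  by (simp_all add: area2_def algebra_simps)

lemma circumcenter_unique:
  assumes a: "area2 x y z \<noteq> 0"
    and m: "(norm (x-m))^2 = k" "(norm (y-m))^2 = k" "(norm (z-m))^2 = k"
    and q: "(norm (x-q))^2 = j" "(norm (y-q))^2 = j" "(norm (z-q))^2 = j"
  shows "q = m"
proof -
  have "2 * area2 x y z * q$1 = 2 * area2 x y z * m$1"
    "2 * area2 x y z * q$2 = 2 * area2 x y z * m$2"
    unfolding circumcenter_coordinate_1[OF m] circumcenter_coordinate_1[OF q]
      circumcenter_coordinate_2[OF m] circumcenter_coordinate_2[OF q] by (rule refl)+
  then show ?thesis using a by (simp add: vec_eq_iff forall_2)
qed

text \<open>
  The classical relation between area, edge lengths and circumradius, here obtained from the power of
  \<open>m\<close> itself, whose areas are known, and Heron's formula.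
\<close>

lemma circumradius_sq:
  assumes a: "area2 x y z \<noteq> 0"
    and m: "(norm (x-m))^2 = k" "(norm (y-m))^2 = k" "(norm (z-m))^2 = k"
  shows "(norm (y-z))^2 * (norm (z-x))^2 * (norm (x-y))^2 = 4 * (area2 x y z)^2 * k"
proof -
  let ?a = "area2 x y z"
  define X Y Z where XYZ: "X = (norm (y-z))^2" "Y = (norm (z-x))^2" "Z = (norm (x-y))^2"
  have "X * (4 * ?a * area2 x m z) * (4 * ?a * area2 x y m)
      + Y * (4 * ?a * area2 x y m) * (4 * ?a * area2 m y z)
      + Z * (4 * ?a * area2 m y z) * (4 * ?a * area2 x m z)
    = 16 * ?a^2 * (X * area2 x m z * area2 x y m + Y * area2 x y m * area2 m y z
        + Z * area2 m y z * area2 x m z)"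
    by algebra
  also have "\<dots> = 16 * ?a^2 * (?a * (?a * k))"
    unfolding XYZ edge_sum_coeff_B coeff_B_power[OF m] by simp
  finally have "X * (4 * ?a * area2 x m z) * (4 * ?a * area2 x y m)
      + Y * (4 * ?a * area2 x y m) * (4 * ?a * area2 m y z)
      + Z * (4 * ?a * area2 m y z) * (4 * ?a * area2 x m z) = 4 * ?a^2 * (4 * ?a^2 * k)" by algebra
  moreover have "4 * ?a * area2 m y z = X * (Y + Z - X)" "4 * ?a * area2 x m z = Y * (Z + X - Y)"
    "4 * ?a * area2 x y m = Z * (X + Y - Z)"
    unfolding XYZ by (rule circumcenter_areas[OF m])+
  ultimately have "X * Y * Z * (2 * (Z * X + X * Y + Y * Z) - (Z^2 + X^2 + Y^2))
      = 4 * ?a^2 * (4 * ?a^2 * k)"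
    by simp algebra
  moreover have "4 * ?a^2 = 2 * (Z * X + X * Y + Y * Z) - (Z^2 + X^2 + Y^2)"
    unfolding XYZ heron_area2 by simp
  ultimately have "4 * ?a^2 * (X * Y * Z) = 4 * ?a^2 * (4 * ?a^2 * k)" by (simp add: mult.commute)
  then have "X * Y * Z = 4 * ?a^2 * k" unfolding mult_cancel_left using a by simp
  then show ?thesis unfolding XYZ .
qed

section \<open>The cubic forms that vanish at the incenter\<close>

text \<open>
  In complex notation this is the imaginary part of \<open>(y - x) * (z - x)\<close> times the square of the
  conjugate of \<open>c - x\<close>. For \<open>c \<noteq> x\<close> it vanishes iff the line through \<open>x\<close> and \<open>c\<close> is the internal or
  external bisector of the angle at \<open>x\<close>.
\<close>

definition bisector_form :: "real^2 \<Rightarrow> real^2 \<Rightarrow> real^2 \<Rightarrow> real^2 \<Rightarrow> real"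
  where "bisector_form x y z c =
    ((y$1 - x$1) * (z$1 - x$1) - (y$2 - x$2) * (z$2 - x$2)) * (- 2 * (x$1 - c$1) * (x$2 - c$2))
    + ((y$1 - x$1) * (z$2 - x$2) + (y$2 - x$2) * (z$1 - x$1)) * ((x$1 - c$1)^2 - (x$2 - c$2)^2)"

text \<open>
  Equality of the distances from \<open>c\<close> to the lines \<open>xy\<close> and \<open>xz\<close>, squared and cleared of
  denominators, is a quadratic equation for \<open>c\<close>. It is divisible by \<open>area2 x y z\<close> because the two
  bisectors of the angle at \<open>x\<close> are already the zeros of \<open>bisector_form\<close>.
\<close>

lemma bisector_form_distances:
  "area2 x y z * bisector_form x y z c
    = (area2 x c z)^2 * (norm (x - y))^2 - (area2 x y c)^2 * (norm (z - x))^2"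
  unfolding bisector_form_def area2_def norm2_sq vector_minus_component by algebra

text \<open>
  As functions of \<open>c\<close>, the coefficients \<open>v\<close> are cubics through the vertices of the triangle, its
  incenter and its three excenters. Cubics of the form below have these zeros: all bisector forms
  vanish at the incenter and the excenters, and at a vertex two of the areas vanish together with
  the bisector form that belongs to the third.
\<close>

lemma coeff_v_bisector_forms:
  fixes x y z c m :: "real^2"
  assumes m: "(norm (x-m))^2 = k" "(norm (y-m))^2 = k" "(norm (z-m))^2 = k"
  shows "area2 x y z * coeff_v1 x y z c m = area2 c y z * bisector_form x y z c * (z$1 - y$1)
      + area2 x c z * bisector_form y z x c * (x$1 - z$1)
      + area2 x y c * bisector_form z x y c * (y$1 - x$1)"
    and "area2 x y z * coeff_v2 x y z c m = area2 c y z * bisector_form x y z c * (z$2 - y$2)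
      + area2 x c z * bisector_form y z x c * (x$2 - z$2)
      + area2 x y c * bisector_form z x y c * (y$2 - x$2)"
proof -
  \<comment> \<open>The circumcenter enters \<open>v\<close> only through its product with \<open>area2 x y z\<close>, a polynomial in
    the vertices.\<close>
  show "area2 x y z * coeff_v1 x y z c m = area2 c y z * bisector_form x y z c * (z$1 - y$1)
      + area2 x c z * bisector_form y z x c * (x$1 - z$1)
      + area2 x y c * bisector_form z x y c * (y$1 - x$1)"
    using circumcenter_coordinate_1[OF m]
    unfolding norm2_sq bisector_form_def area2_def coeff_v1_def by algebra
  show "area2 x y z * coeff_v2 x y z c m = area2 c y z * bisector_form x y z c * (z$2 - y$2)
      + area2 x c z * bisector_form y z x c * (x$2 - z$2)
      + area2 x y c * bisector_form z x y c * (y$2 - x$2)"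
    using circumcenter_coordinate_2[OF m]
    unfolding norm2_sq bisector_form_def area2_def coeff_v2_def by algebra
qed

lemma coeff_v_incenter:
  fixes x y z c m :: "real^2"
  assumes a: "area2 x y z \<noteq> 0"
    and m: "(norm (x-m))^2 = k" "(norm (y-m))^2 = k" "(norm (z-m))^2 = k"
    and c: "area2 c y z = \<kappa> * norm (y - z)" "area2 x c z = \<kappa> * norm (z - x)"
      "area2 x y c = \<kappa> * norm (x - y)"
  shows "coeff_v1 x y z c m = 0" and "coeff_v2 x y z c m = 0"
proof -
  have bisects: "bisector_form p q s c = 0"
    if "area2 p q s \<noteq> 0" "area2 p c s = \<kappa> * norm (s - p)" "area2 p q c = \<kappa> * norm (p - q)"
    for p q s
    using that bisector_form_distances[of p q s c] by (simp add: power_mult_distrib)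
  have rotate: "area2 y z x = area2 x y z" "area2 z x y = area2 x y z"
    "area2 y c x = area2 x y c" "area2 y z c = area2 c y z"
    "area2 z c y = area2 c y z" "area2 z x c = area2 x c z"
    by (simp_all add: area2_def)
  have "bisector_form x y z c = 0" "bisector_form y z x c = 0" "bisector_form z x y c = 0"
    by (rule bisects; simp add: rotate a c)+
  then show "coeff_v1 x y z c m = 0" "coeff_v2 x y z c m = 0"
    using coeff_v_bisector_forms[OF m, of c] a by simp_all
qed

section \<open>The gap as a polynomial in the squared inradius\<close>

text \<open>
  The negated linear coefficient, as a polynomial in \<open>t\<close>, of the sum of
  \<open>X\<^sub>i a\<^sub>i (a\<^sub>j\<^sup>2 - t X\<^sub>j) (a\<^sub>k\<^sup>2 - t X\<^sub>k)\<close> over the three choices of \<open>i\<close>, with \<open>j\<close> and \<open>k\<close> the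
  other two indices.
\<close>

definition mixed_form :: "real \<Rightarrow> real \<Rightarrow> real \<Rightarrow> real \<Rightarrow> real \<Rightarrow> real \<Rightarrow> real"
  where "mixed_form X\<^sub>1 X\<^sub>2 X\<^sub>3 a\<^sub>1 a\<^sub>2 a\<^sub>3 =
    X\<^sub>1 * a\<^sub>1 * (X\<^sub>2 * a\<^sub>3^2 + X\<^sub>3 * a\<^sub>2^2) + X\<^sub>2 * a\<^sub>2 * (X\<^sub>3 * a\<^sub>1^2 + X\<^sub>1 * a\<^sub>3^2)
    + X\<^sub>3 * a\<^sub>3 * (X\<^sub>1 * a\<^sub>2^2 + X\<^sub>2 * a\<^sub>1^2)"

text \<open>
  The configuration in real parameters: \<open>w\<close> and \<open>h\<close> are the heights of the apex and of the
  circumcenter, \<open>k - e\<close> and \<open>k - f\<close> the negated powers of the touching point and of the foot of the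
  apex in the circumcircle of the base. Adding up the tangency relations determines \<open>w\<close>, inserting
  them into the power of the foot determines \<open>h\<close>, and the gap is affine in \<open>h\<close>. The constant term of
  the resulting polynomial in \<open>r\<^sup>2\<close> cancels because the constant term of the sum \<open>T\<close> below is
  again a multiple of the power of the touching point.
\<close>

lemma gap_expansion:
  fixes a\<^sub>1 a\<^sub>2 a\<^sub>3 X\<^sub>1 X\<^sub>2 X\<^sub>3 l\<^sub>1 l\<^sub>2 l\<^sub>3 a w h r k e f R d :: real
  defines "A \<equiv> a\<^sub>1 * a\<^sub>2 * a\<^sub>3"
    and "D \<equiv> a\<^sub>1 * a\<^sub>2 * a\<^sub>3 - a * (k - e) * r^2"
    and "S \<equiv> mixed_form X\<^sub>1 X\<^sub>2 X\<^sub>3 a\<^sub>1 a\<^sub>2 a\<^sub>3"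
  assumes pos: "0 < a\<^sub>1" "0 < a\<^sub>2" "0 < a\<^sub>3" "0 < r" "0 < w"
    and sum_a: "a\<^sub>1 + a\<^sub>2 + a\<^sub>3 = a" and sum_l: "l\<^sub>1 + l\<^sub>2 + l\<^sub>3 = a"
    and face: "w * (a\<^sub>1^2 - r^2 * X\<^sub>1) = 2 * r * a\<^sub>1 * l\<^sub>1"
      "w * (a\<^sub>2^2 - r^2 * X\<^sub>2) = 2 * r * a\<^sub>2 * l\<^sub>2"
      "w * (a\<^sub>3^2 - r^2 * X\<^sub>3) = 2 * r * a\<^sub>3 * l\<^sub>3"
    and power_c: "X\<^sub>1 * a\<^sub>2 * a\<^sub>3 + X\<^sub>2 * a\<^sub>3 * a\<^sub>1 + X\<^sub>3 * a\<^sub>1 * a\<^sub>2 = a^2 * (k - e)"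
    and power_f: "X\<^sub>1 * l\<^sub>2 * l\<^sub>3 + X\<^sub>2 * l\<^sub>3 * l\<^sub>1 + X\<^sub>3 * l\<^sub>1 * l\<^sub>2 = a^2 * (k - f)"
    and radius: "X\<^sub>1 * X\<^sub>2 * X\<^sub>3 = 4 * a^2 * k"
    and height: "2 * w * h = w^2 + f - k"
    and R: "R^2 = k + h^2" and d: "d^2 = e + (h - r)^2"
  shows "0 < D"
    and "a^2 * (gap r R d * D) =
      r^2 * ((k - e) * S - a^2 * (4 * k * A + a * (k - e)^3))
      + r^4 * (8 * a^3 * (k - e)^2 - 4 * S) + 16 * a^3 * r^6 * e"
proof -
  have a: "0 < a" and A: "0 < A" using pos sum_a by (auto simp: A_def)
  have "a * (w * D) = w * (a * A - r^2 * (a^2 * (k - e)))"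
    unfolding D_def A_def by algebra
  also have "\<dots> = w * ((a\<^sub>1 + a\<^sub>2 + a\<^sub>3) * A
      - r^2 * (X\<^sub>1 * a\<^sub>2 * a\<^sub>3 + X\<^sub>2 * a\<^sub>3 * a\<^sub>1 + X\<^sub>3 * a\<^sub>1 * a\<^sub>2))"
    unfolding sum_a power_c ..
  also have "\<dots> = w * (a\<^sub>1^2 - r^2 * X\<^sub>1) * a\<^sub>2 * a\<^sub>3 + w * (a\<^sub>2^2 - r^2 * X\<^sub>2) * a\<^sub>3 * a\<^sub>1
      + w * (a\<^sub>3^2 - r^2 * X\<^sub>3) * a\<^sub>1 * a\<^sub>2"
    unfolding A_def by algebra
  also have "\<dots> = a * (2 * r * A)" unfolding face A_def sum_l[symmetric] by algebra
  finally have wD: "w * D = 2 * r * A" using a by simp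
  have "0 < w * D" unfolding wD using A pos by simp
  then show "0 < D" using pos by (simp add: zero_less_mult_iff)
  define T where "T = X\<^sub>1 * a\<^sub>1 * (a\<^sub>2^2 - r^2 * X\<^sub>2) * (a\<^sub>3^2 - r^2 * X\<^sub>3)
      + X\<^sub>2 * a\<^sub>2 * (a\<^sub>3^2 - r^2 * X\<^sub>3) * (a\<^sub>1^2 - r^2 * X\<^sub>1)
      + X\<^sub>3 * a\<^sub>3 * (a\<^sub>1^2 - r^2 * X\<^sub>1) * (a\<^sub>2^2 - r^2 * X\<^sub>2)"
  \<comment> \<open>\<open>T\<close> is, up to a factor, the left side of \<open>power_f\<close> after
    eliminating the \<open>l\<^sub>i\<close> by means of \<open>face\<close>\<close>
  have "w^2 * T = X\<^sub>1 * a\<^sub>1 * (w * (a\<^sub>2^2 - r^2 * X\<^sub>2)) * (w * (a\<^sub>3^2 - r^2 * X\<^sub>3))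
      + X\<^sub>2 * a\<^sub>2 * (w * (a\<^sub>3^2 - r^2 * X\<^sub>3)) * (w * (a\<^sub>1^2 - r^2 * X\<^sub>1))
      + X\<^sub>3 * a\<^sub>3 * (w * (a\<^sub>1^2 - r^2 * X\<^sub>1)) * (w * (a\<^sub>2^2 - r^2 * X\<^sub>2))"
    unfolding T_def by algebra
  also have "\<dots> = 4 * r^2 * A * (X\<^sub>1 * l\<^sub>2 * l\<^sub>3 + X\<^sub>2 * l\<^sub>3 * l\<^sub>1 + X\<^sub>3 * l\<^sub>1 * l\<^sub>2)"
    unfolding face A_def by algebra
  also have "\<dots> = 4 * r^2 * A * (a^2 * (w^2 - 2 * w * h))"
    unfolding power_f height by simp
  also have "\<dots> = w * (4 * r^2 * A * a^2 * (w - 2 * h))" by algebra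
  finally have "w * (w * T) = w * (4 * r^2 * A * a^2 * (w - 2 * h))"
    by (simp add: power2_eq_square mult.assoc)
  then have wT: "w * T = 4 * r^2 * A * a^2 * (w - 2 * h)" using pos by simp
  have "(w * D) * T = D * (w * T)" by simp
  also have "\<dots> = 4 * r^2 * A * a^2 * (w * D) - 8 * r^2 * A * a^2 * h * D"
    unfolding wT by algebra
  finally have "(2 * r * A) * T = (2 * r * A) * (4 * r^2 * A * a^2 - 4 * r * h * D * a^2)"
    unfolding wD by algebra
  then have hD: "4 * r * h * D * a^2 = 4 * r^2 * A * a^2 - T" using A pos by simp
  have T: "T = A * (a^2 * (k - e)) - r^2 * S + r^4 * (4 * a^3 * k)"
  proof -
    have "T = A * (X\<^sub>1 * a\<^sub>2 * a\<^sub>3 + X\<^sub>2 * a\<^sub>3 * a\<^sub>1 + X\<^sub>3 * a\<^sub>1 * a\<^sub>2) - r^2 * S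
        + r^4 * (X\<^sub>1 * X\<^sub>2 * X\<^sub>3) * (a\<^sub>1 + a\<^sub>2 + a\<^sub>3)"
      unfolding T_def A_def S_def mixed_form_def by algebra
    then show ?thesis unfolding power_c radius sum_a by algebra
  qed
  have "gap r R d = (R^2 - d^2 - 3 * r^2)^2 - 4 * r^2 * R^2"
    by (simp add: gap_def power_mult_distrib)
  also have "\<dots> = (k - e - 4 * r^2)^2 + 4 * r * h * (k - e - 4 * r^2) - 4 * r^2 * k"
    unfolding R d by algebra
  finally have gap: "gap r R d = \<dots>" .
  have "a^2 * (gap r R d * D) =
      a^2 * D * ((k - e - 4 * r^2)^2 - 4 * r^2 * k) + (k - e - 4 * r^2) * (4 * r * h * D * a^2)"
    unfolding gap by algebra
  also have "\<dots> = r^2 * ((k - e) * S - a^2 * (4 * k * A + a * (k - e)^3))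
      + r^4 * (8 * a^3 * (k - e)^2 - 4 * S) + 16 * a^3 * r^6 * e"
    unfolding hD unfolding T D_def A_def by algebra
  finally show "a^2 * (gap r R d * D) =
      r^2 * ((k - e) * S - a^2 * (4 * k * A + a * (k - e)^3))
      + r^4 * (8 * a^3 * (k - e)^2 - 4 * S) + 16 * a^3 * r^6 * e" .
qed

text \<open>
  All quantities are rational functions of the squared edge lengths. The first relation makes the
  term of degree 2 in \<open>gap_expansion\<close> vanish for \<open>e = 0\<close>, the second evaluates what is left of
  degree 1.
\<close>

lemma circumcenter_relations:
  fixes X\<^sub>1 X\<^sub>2 X\<^sub>3 a\<^sub>1 a\<^sub>2 a\<^sub>3 a k :: real
  assumes a: "0 < a"
    and areas: "4 * a * a\<^sub>1 = X\<^sub>1 * (X\<^sub>2 + X\<^sub>3 - X\<^sub>1)" "4 * a * a\<^sub>2 = X\<^sub>2 * (X\<^sub>3 + X\<^sub>1 - X\<^sub>2)"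
      "4 * a * a\<^sub>3 = X\<^sub>3 * (X\<^sub>1 + X\<^sub>2 - X\<^sub>3)"
    and heron: "4 * a^2 = 2 * (X\<^sub>1 * X\<^sub>2 + X\<^sub>2 * X\<^sub>3 + X\<^sub>3 * X\<^sub>1) - (X\<^sub>1^2 + X\<^sub>2^2 + X\<^sub>3^2)"
    and radius: "X\<^sub>1 * X\<^sub>2 * X\<^sub>3 = 4 * a^2 * k"
  shows "mixed_form X\<^sub>1 X\<^sub>2 X\<^sub>3 a\<^sub>1 a\<^sub>2 a\<^sub>3 = 2 * a^3 * k^2"
    and "4 * a * (a * k^2 - 4 * (a\<^sub>1 * a\<^sub>2 * a\<^sub>3))
      = k * (X\<^sub>1 * X\<^sub>2 * X\<^sub>3 - (X\<^sub>2 + X\<^sub>3 - X\<^sub>1) * (X\<^sub>3 + X\<^sub>1 - X\<^sub>2) * (X\<^sub>1 + X\<^sub>2 - X\<^sub>3))"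
proof -
  let ?S = "mixed_form X\<^sub>1 X\<^sub>2 X\<^sub>3 a\<^sub>1 a\<^sub>2 a\<^sub>3"
  let ?P = "(X\<^sub>2 + X\<^sub>3 - X\<^sub>1) * (X\<^sub>3 + X\<^sub>1 - X\<^sub>2) * (X\<^sub>1 + X\<^sub>2 - X\<^sub>3)"
  have "64 * a^3 * ?S = X\<^sub>1 * (4 * a * a\<^sub>1) * (X\<^sub>2 * (4 * a * a\<^sub>3)^2 + X\<^sub>3 * (4 * a * a\<^sub>2)^2)
      + X\<^sub>2 * (4 * a * a\<^sub>2) * (X\<^sub>3 * (4 * a * a\<^sub>1)^2 + X\<^sub>1 * (4 * a * a\<^sub>3)^2)
      + X\<^sub>3 * (4 * a * a\<^sub>3) * (X\<^sub>1 * (4 * a * a\<^sub>2)^2 + X\<^sub>2 * (4 * a * a\<^sub>1)^2)"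
    unfolding mixed_form_def by algebra
  also have "\<dots> = 2 * (X\<^sub>1 * X\<^sub>2 * X\<^sub>3)^2
      * (2 * (X\<^sub>1 * X\<^sub>2 + X\<^sub>2 * X\<^sub>3 + X\<^sub>3 * X\<^sub>1) - (X\<^sub>1^2 + X\<^sub>2^2 + X\<^sub>3^2))"
    unfolding areas by algebra
  also have "\<dots> = 64 * a^3 * (2 * a^3 * k^2)" unfolding heron[symmetric] radius by algebra
  finally show "?S = 2 * a^3 * k^2" unfolding mult_cancel_left using a by simp
  have "64 * a^3 * (a\<^sub>1 * a\<^sub>2 * a\<^sub>3) = (4 * a * a\<^sub>1) * (4 * a * a\<^sub>2) * (4 * a * a\<^sub>3)" by algebra
  also have "\<dots> = X\<^sub>1 * X\<^sub>2 * X\<^sub>3 * ?P" unfolding areas by algebra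
  also have "\<dots> = 4 * a^2 * (k * ?P)" unfolding radius by algebra
  finally have "4 * a^2 * (16 * a * (a\<^sub>1 * a\<^sub>2 * a\<^sub>3)) = 4 * a^2 * (k * ?P)" by algebra
  then have "16 * a * (a\<^sub>1 * a\<^sub>2 * a\<^sub>3) = k * ?P" unfolding mult_cancel_left using a by simp
  then show "4 * a * (a * k^2 - 4 * (a\<^sub>1 * a\<^sub>2 * a\<^sub>3)) = k * (X\<^sub>1 * X\<^sub>2 * X\<^sub>3 - ?P)"
    unfolding right_diff_distrib radius by algebra
qed

text \<open>
  The hypotheses force \<open>a * t = \<kappa> * L\<^sub>1 * L\<^sub>2 * L\<^sub>3\<close>, Euler's relation between the power of the incenter, the
  inradius \<open>\<kappa>\<close> and the circumradius. Together the conclusions say that in \<open>gap_expansion\<close> the terms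
  of degree 1 and 2 vanish.
\<close>

lemma incenter_relations:
  fixes L\<^sub>1 L\<^sub>2 L\<^sub>3 a\<^sub>1 a\<^sub>2 a\<^sub>3 a k \<kappa> t :: real
  assumes a: "0 < a" and sum_a: "a\<^sub>1 + a\<^sub>2 + a\<^sub>3 = a"
    and areas: "a\<^sub>1 = \<kappa> * L\<^sub>1" "a\<^sub>2 = \<kappa> * L\<^sub>2" "a\<^sub>3 = \<kappa> * L\<^sub>3"
    and power_c: "L\<^sub>1^2 * a\<^sub>2 * a\<^sub>3 + L\<^sub>2^2 * a\<^sub>3 * a\<^sub>1 + L\<^sub>3^2 * a\<^sub>1 * a\<^sub>2 = a^2 * t"
    and radius: "L\<^sub>1^2 * L\<^sub>2^2 * L\<^sub>3^2 = 4 * a^2 * k"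
  shows "mixed_form (L\<^sub>1^2) (L\<^sub>2^2) (L\<^sub>3^2) a\<^sub>1 a\<^sub>2 a\<^sub>3 = 2 * a^3 * t^2"
    and "4 * k * (a\<^sub>1 * a\<^sub>2 * a\<^sub>3) = a * t^3"
proof -
  define N where "N = L\<^sub>1 * L\<^sub>2 * L\<^sub>3"
  have "a * (a * t) = \<kappa> * N * (a\<^sub>1 + a\<^sub>2 + a\<^sub>3)"
    using power_c unfolding areas N_def power2_eq_square by (simp add: algebra_simps)
  then have at: "a * t = \<kappa> * N" unfolding sum_a using a by simp
  have "mixed_form (L\<^sub>1^2) (L\<^sub>2^2) (L\<^sub>3^2) a\<^sub>1 a\<^sub>2 a\<^sub>3 = 2 * (\<kappa> * N)^2 * (a\<^sub>1 + a\<^sub>2 + a\<^sub>3)"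
    unfolding areas N_def mixed_form_def by algebra
  also have "\<dots> = 2 * a^3 * t^2" unfolding at[symmetric] sum_a by algebra
  finally show "mixed_form (L\<^sub>1^2) (L\<^sub>2^2) (L\<^sub>3^2) a\<^sub>1 a\<^sub>2 a\<^sub>3 = 2 * a^3 * t^2" .
  have "a^2 * (4 * k * (a\<^sub>1 * a\<^sub>2 * a\<^sub>3)) = (4 * a^2 * k) * (a\<^sub>1 * a\<^sub>2 * a\<^sub>3)" by algebra
  also have "\<dots> = (\<kappa> * N)^3" unfolding radius[symmetric] areas N_def by algebra
  also have "\<dots> = a^2 * (a * t^3)" unfolding at[symmetric] by algebra
  finally show "4 * k * (a\<^sub>1 * a\<^sub>2 * a\<^sub>3) = a * t^3" unfolding mult_cancel_left using a by simp
qed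

lemma gap_tetrahedron:
  fixes x y z c m :: "real^2" and w p q :: "real^3" and r R k :: real
  defines "a\<^sub>1 \<equiv> area2 c y z" and "a\<^sub>2 \<equiv> area2 x c z" and "a\<^sub>3 \<equiv> area2 x y c" and "a \<equiv> area2 x y z"
    and "X\<^sub>1 \<equiv> (norm (y - z))^2" and "X\<^sub>2 \<equiv> (norm (z - x))^2" and "X\<^sub>3 \<equiv> (norm (x - y))^2"
    and "e \<equiv> (norm (c - m))^2"
    and "D \<equiv> coeff_A x y z c - coeff_B x y z c * r^2"
  assumes ccw: "0 < area2 x y z"
    and w3: "0 < w$3"
    and insphere: "is_insphere {flat x, flat y, flat z, w} p r"
    and circumsphere: "is_circumsphere {flat x, flat y, flat z, w} q R"
    and touch: "touches_at (sphere p r) (convex hull {flat x, flat y, flat z}) (flat c)"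
    and m: "(norm (x-m))^2 = k" "(norm (y-m))^2 = k" "(norm (z-m))^2 = k"
  shows "0 < D"
    and "a^2 * (gap r R (dist p q) * D) =
      r^2 * ((k - e) * mixed_form X\<^sub>1 X\<^sub>2 X\<^sub>3 a\<^sub>1 a\<^sub>2 a\<^sub>3
        - a^2 * (4 * k * (a\<^sub>1 * a\<^sub>2 * a\<^sub>3) + a * (k - e)^3))
      + r^4 * (8 * a^3 * (k - e)^2 - 4 * mixed_form X\<^sub>1 X\<^sub>2 X\<^sub>3 a\<^sub>1 a\<^sub>2 a\<^sub>3)
      + 16 * a^3 * r^6 * e"
proof -
  define f where "f = (vector [w$1, w$2] :: real^2)"
  have f: "f$1 = w$1" "f$2 = w$2" by (simp_all add: f_def)
  have r: "0 < r" using insphere by (simp add: is_insphere_def)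
  note p = insphere_center_above_touching_point[OF w3 insphere touch]
  have rot: "area2 y z x = area2 x y z" "area2 z x y = area2 x y z"
    "area2 y z u = area2 u y z" "area2 z x u = area2 x u z" for u
    by (simp_all add: area2_def)
  \<comment> \<open>the three lateral faces, indexed by the base vertex that they miss\<close>
  note face3 = lateral_face_tangency[OF ccw w3 insphere p, folded f_def]
  have "is_insphere {flat y, flat z, flat x, w} p r" using insphere by (simp add: insert_commute)
  note face1 = lateral_face_tangency[OF _ w3 this p, folded f_def, unfolded rot, OF ccw]
  have "is_insphere {flat z, flat x, flat y, w} p r" using insphere by (simp add: insert_commute)
  note face2 = lateral_face_tangency[OF _ w3 this p, folded f_def, unfolded rot, OF ccw]
  define h where "h = q$3"
  \<comment> \<open>the orthogonal projection of \<open>q\<close> to the base plane is equidistant from the base vertices\<close>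
  define q' where "q' = (vector [q$1, q$2] :: real^2)"
  have on: "(norm (v - q))^2 = R^2" if "v \<in> {flat x, flat y, flat z, w}" for v
    using that circumsphere by (auto simp: is_circumsphere_def dist_norm norm_minus_commute)
  have "(norm (v - q'))^2 = R^2 - h^2" if "v \<in> {x, y, z}" for v
    using on[of "flat v"] that unfolding norm2_sq norm3_sq by (auto simp: q'_def h_def)
  then have q': "(norm (x - q'))^2 = R^2 - h^2" "(norm (y - q'))^2 = R^2 - h^2"
    "(norm (z - q'))^2 = R^2 - h^2"
    by simp_all
  have qm: "q' = m" using circumcenter_unique[OF _ m q'] ccw by simp
  then have R: "R^2 = k + h^2" using q'(1) m(1) by simp
  have q: "q$1 = m$1" "q$2 = m$2" unfolding qm[symmetric] q'_def by simp_all
  have height: "2 * w$3 * h = (w$3)^2 + (norm (f - m))^2 - k"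
    using on[of w] unfolding norm2_sq norm3_sq f q h_def[symmetric] R
    by (simp add: power2_diff f q h_def)
  have d: "(dist p q)^2 = e + (h - r)^2"
    unfolding dist_norm e_def norm2_sq norm3_sq by (simp add: p q h_def power2_commute)
  have sums: "area2 u y z + area2 x u z + area2 x y u = a" for u
    by (simp add: a_def area2_def)
  \<comment> \<open>used both for the touching point and for the foot of the apex\<close>
  have power: "X\<^sub>1 * area2 x u z * area2 x y u + X\<^sub>2 * area2 x y u * area2 u y z
      + X\<^sub>3 * area2 u y z * area2 x u z = a^2 * (k - (norm (u - m))^2)" for u
    unfolding X\<^sub>1_def X\<^sub>2_def X\<^sub>3_def edge_sum_coeff_B coeff_B_power[OF m] a_def by algebra
  have radius: "X\<^sub>1 * X\<^sub>2 * X\<^sub>3 = 4 * a^2 * k"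
    using circumradius_sq[OF _ m] ccw unfolding X\<^sub>1_def X\<^sub>2_def X\<^sub>3_def a_def by simp
  have D: "D = a\<^sub>1 * a\<^sub>2 * a\<^sub>3 - a * (k - e) * r^2"
    unfolding D_def coeff_A_def coeff_B_power[OF m] a\<^sub>1_def a\<^sub>2_def a\<^sub>3_def a_def e_def ..
  note expansion = gap_expansion[OF face1(1) face2(1) face3(1) r w3 sums sums
      face1(2) face2(2) face3(2),
      folded X\<^sub>1_def X\<^sub>2_def X\<^sub>3_def, OF power power radius height R d[unfolded e_def],
      folded e_def a\<^sub>1_def a\<^sub>2_def a\<^sub>3_def, folded D]
  show "0 < D" by (rule expansion(1))
  show "a^2 * (gap r R (dist p q) * D) =
      r^2 * ((k - e) * mixed_form X\<^sub>1 X\<^sub>2 X\<^sub>3 a\<^sub>1 a\<^sub>2 a\<^sub>3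
        - a^2 * (4 * k * (a\<^sub>1 * a\<^sub>2 * a\<^sub>3) + a * (k - e)^3))
      + r^4 * (8 * a^3 * (k - e)^2 - 4 * mixed_form X\<^sub>1 X\<^sub>2 X\<^sub>3 a\<^sub>1 a\<^sub>2 a\<^sub>3)
      + 16 * a^3 * r^6 * e"
    by (rule expansion(2))
qed

theorem lemma2:
  fixes x y z c m :: "real^2"
    and w p q :: "real^3"
    and r R :: real
  assumes ccw: "0 < area2 x y z"
    and w3: "0 < w$3"
    and insphere: "is_insphere {flat x, flat y, flat z, w} p r"
    and circumsphere: "is_circumsphere {flat x, flat y, flat z, w} q R"
    and touch: "touches_at (sphere p r) (convex hull {flat x, flat y, flat z}) (flat c)"
    and circumcenter: "is_circumcenter {x, y, z} m"
  shows "(c$1 = m$1 \<and> c$2 = m$2 \<longrightarrow>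
            coeff_u1 x y z c m = 0 \<and> coeff_u2 x y z c m = 0 \<and>
            gap r R (dist p q) =
              r^2 / (64 * (area2 x y z)^5 * (coeff_A x y z c - coeff_B x y z c * r^2))
              * (norm (x - y))^4 * (norm (y - z))^4 * (norm (z - x))^4
              * ((coeff_g1 x y z)^2 + (coeff_g2 x y z)^2)) \<and>
         (is_incenter {x, y, z} c \<longrightarrow>
            coeff_v1 x y z c m = 0 \<and> coeff_v2 x y z c m = 0 \<and>
            gap r R (dist p q) =
              16 * area2 x y z * r^6 / (coeff_A x y z c - coeff_B x y z c * r^2)
              * ((c$1 - m$1)^2 + (c$2 - m$2)^2)) \<and>
         (norm (x - y) = norm (y - z) \<and> norm (y - z) = norm (z - x) \<and>
          c$1 = m$1 \<and> c$2 = m$2 \<longrightarrow>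
            gap r R (dist p q) = 0)"
proof -
  define a where "a = area2 x y z"
  define X\<^sub>1 X\<^sub>2 X\<^sub>3 where X: "X\<^sub>1 = (norm (y - z))^2" "X\<^sub>2 = (norm (z - x))^2"
    "X\<^sub>3 = (norm (x - y))^2"
  define a\<^sub>1 a\<^sub>2 a\<^sub>3 where as: "a\<^sub>1 = area2 c y z" "a\<^sub>2 = area2 x c z" "a\<^sub>3 = area2 x y c"
  define D where "D = coeff_A x y z c - coeff_B x y z c * r^2"
  define S where "S = mixed_form X\<^sub>1 X\<^sub>2 X\<^sub>3 a\<^sub>1 a\<^sub>2 a\<^sub>3"
  define e where "e = (norm (c - m))^2"
  define G where "G = gap r R (dist p q)"
  obtain \<rho> where "{x, y, z} \<subseteq> sphere m \<rho>"
    using circumcenter by (auto simp: is_circumcenter_def is_circumsphere_def)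
  then have m: "(norm (x-m))^2 = \<rho>^2" "(norm (y-m))^2 = \<rho>^2" "(norm (z-m))^2 = \<rho>^2"
    by (auto simp: dist_norm norm_minus_commute)
  define k where "k = \<rho>^2"
  note m = m[folded k_def]
  have a: "0 < a" using ccw by (simp add: a_def)
  note expansion = gap_tetrahedron[OF ccw w3 insphere circumsphere touch m,
      folded a_def X as e_def D_def G_def, folded S_def]
  note D = expansion(1)
  have radius: "X\<^sub>1 * X\<^sub>2 * X\<^sub>3 = 4 * a^2 * k"
    using circumradius_sq[OF _ m] ccw unfolding X a_def by simp
  have at_circumcenter: "G = r^2 / (64 * a^5 * D)
      * (norm (x - y))^4 * (norm (y - z))^4 * (norm (z - x))^4
      * ((coeff_g1 x y z)^2 + (coeff_g2 x y z)^2)" if "c$1 = m$1 \<and> c$2 = m$2"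
  proof -
    have cm: "c = m" using that by (simp add: vec_eq_iff forall_2)
    then have e: "e = 0" by (simp add: e_def)
    define g where "g = (coeff_g1 x y z)^2 + (coeff_g2 x y z)^2"
    have heron': "4 * a^2 = 2 * (X\<^sub>1 * X\<^sub>2 + X\<^sub>2 * X\<^sub>3 + X\<^sub>3 * X\<^sub>1) - (X\<^sub>1^2 + X\<^sub>2^2 + X\<^sub>3^2)"
      unfolding X a_def heron_area2 by simp
    note areas = circumcenter_areas[OF m, folded a_def X cm, folded as]
    note special = circumcenter_relations[OF a areas heron' radius, folded S_def]
    have "a^2 * (G * D) = a^2 * (r^2 * k * (a * k^2 - 4 * (a\<^sub>1 * a\<^sub>2 * a\<^sub>3)))"
      unfolding expansion(2) special(1) e by algebra
    then have "G * D = r^2 * k * (a * k^2 - 4 * (a\<^sub>1 * a\<^sub>2 * a\<^sub>3))"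
      unfolding mult_cancel_left using a by simp
    then have "4 * a * (G * D) = r^2 * k * (4 * a * (a * k^2 - 4 * (a\<^sub>1 * a\<^sub>2 * a\<^sub>3)))" by simp
    also have "\<dots> = r^2 * k^2 * g"
      unfolding special(2) g_def coeff_g_norm_sq X by algebra
    finally have "G = r^2 * k^2 * g / (4 * a * D)" using a D by (simp add: field_simps)
    also have "\<dots> = r^2 / (64 * a^5 * D) * (4 * a^2 * k)^2 * g"
      using a D by (simp add: field_simps power2_eq_square eval_nat_numeral)
    also have "(4 * a^2 * k)^2 = (norm (x - y))^4 * (norm (y - z))^4 * (norm (z - x))^4"
      unfolding radius[symmetric] X by algebra
    finally show ?thesis unfolding g_def by (simp add: mult.assoc)
  qed
  have at_incenter: "coeff_v1 x y z c m = 0 \<and> coeff_v2 x y z c m = 0 \<and>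
      G = 16 * a * r^6 / D * ((c$1 - m$1)^2 + (c$2 - m$2)^2)"
    if incenter: "is_incenter {x, y, z} c"
  proof -
    obtain \<kappa> where c: "is_insphere {x, y, z} c \<kappa>"
      using incenter unfolding is_incenter_def by blast
    have c': "is_insphere {y, z, x} c \<kappa>" "is_insphere {z, x, y} c \<kappa>"
      using c by (simp_all add: insert_commute)
    have sides: "a\<^sub>1 = \<kappa> * norm (y - z)" "a\<^sub>2 = \<kappa> * norm (z - x)" "a\<^sub>3 = \<kappa> * norm (x - y)"
      using incenter_side_distance[OF _ c'(1)] incenter_side_distance[OF _ c'(2)]
        incenter_side_distance[OF ccw c] ccw unfolding as by (simp_all add: area2_def algebra_simps)
    have "a\<^sub>1 + a\<^sub>2 + a\<^sub>3 = a" unfolding as a_def by (simp add: area2_def)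
    moreover have "X\<^sub>1 * a\<^sub>2 * a\<^sub>3 + X\<^sub>2 * a\<^sub>3 * a\<^sub>1 + X\<^sub>3 * a\<^sub>1 * a\<^sub>2 = a^2 * (k - e)"
      unfolding X as edge_sum_coeff_B coeff_B_power[OF m] a_def e_def by algebra
    ultimately have special: "S = 2 * a^3 * (k - e)^2" "4 * k * (a\<^sub>1 * a\<^sub>2 * a\<^sub>3) = a * (k - e)^3"
      using incenter_relations[OF a _ sides] radius unfolding X S_def by blast+
    have "a^2 * (G * D) = a^2 * (16 * a * r^6 * e)"
      unfolding expansion(2) special by algebra
    then have "G * D = 16 * a * r^6 * e"
      unfolding mult_cancel_left using a by simp
    then have "G = 16 * a * r^6 / D * e" using D by (simp add: field_simps)
    moreover have "e = (c$1 - m$1)^2 + (c$2 - m$2)^2" unfolding e_def norm2_sq by simp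
    moreover have "area2 x y z \<noteq> 0" using ccw by simp
    note coeff_v_incenter[OF this m sides[unfolded as]]
    ultimately show ?thesis by simp
  qed
  have "(coeff_g1 x y z)^2 + (coeff_g2 x y z)^2 = 0"
    if "norm (x - y) = norm (y - z)" "norm (y - z) = norm (z - x)"
    unfolding coeff_g_norm_sq that by algebra
  with at_circumcenter at_incenter show ?thesis
    unfolding G_def a_def D_def by (simp add: coeff_u1_def coeff_u2_def)
qed

end
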